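(* Each of the interpolating rules Hyp-A, Hyp-B, Comb and Division below preserves validity of (ceiling-)annotated sequents: whenever all premises of an instance of one of these rules are valid, its conclusion is valid. For fixed $A,B$: (1) Hyp-A: derive $(A,B)\vdash (t\le0)\,[t\le 0]$ if $(t\le0)$ or $(t=0)$ is a conjunct of $A$. (2) Hyp-B: derive $(A,B)\vdash (t\le0)\,[0\le 0]$ if $(t\le0)$ or $(t=0)$ is a conjunct of $B$. (3) Comb: from $(A,B)\vdash(t_1\le0)[t_1'\le0]$ and $(A,B)\vdash(t_2\le0)[t_2'\le0]$ derive $(A,B)\vdash(c_1t_1+c_2t_2\le0)[c_1t_1'+c_2t_2'\le0]$, for $c_1,c_2>0$. (4) Division: from $(A,B)\vdash(\sum_ia_ix_i+\sum_jc_jy_j+\sum_kb_kz_k+c\le0)\,[\sum_ia_ix_i+\sum_jc_j'y_j+c'\le0]$ derive $(A,B)\vdash\big(\sum_i\frac{a_i}{d}x_i+\sum_j\frac{c_j}{d}y_j+\sum_k\frac{b_k}{d}z_k+\lceil\frac{c}{d}\rceil\le0\big)\,\big[\sum_i\frac{a_i}{d}x_i+\lceil\frac{\sum_jc_j'y_j+c'}{d}\rceil\le0\big]$, where the $x_i$ do not occur in $B$, the $y_j$ occur in both $A$ and $B$, the $z_k$ do not occur in $A$, and $d>0$ is an integer dividing all the $a_i$, $c_j$ and $b_k$.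
   Context: Variables range over $\mathbb{Z}$; the signature of linear integer arithmetic is extended with the ceiling function $\lceil\cdot\rceil$, and non-variable terms may take non-integer (rational) values (terms may have rational coefficients); $\models$ is entailment over integer assignments to the variables. $A,B$ are conjunctions of linear equalities and inequalities over integer variables. $\phi\preceq\psi$ means every variable occurring in $\phi$ occurs in $\psi$. An annotated sequent $(A,B)\vdash(t\le0)[t'\le0]$ (with $t,t'$ terms, possibly with ceilings) is valid when: (1) $A\models(t'\le0)$; (2) $B\models(t-t'\le0)$; (3) $t'\preceq A$ and $(t-t')\preceq B$. *)

theory Defs
  imports Complex_Main
begin

section \<open>Terms with ceilings\<close>

datatype 'v raw_trm =
    RVar 'v
  | RConst rat
  | RAdd "'v raw_trm" "'v raw_trm"
  | RScale rat "'v raw_trm"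
  | RCeil "'v raw_trm"

text \<open>
  Terms are identified modulo linear arithmetic over the rationals, with the ceiling treated as an
  uninterpreted function symbol: like terms are collected, so that for instance \<open>t - t\<close> is the term
  0 and contains no variables.  No arithmetic law about the ceiling is built in.
\<close>

inductive lin_eq :: "'v raw_trm \<Rightarrow> 'v raw_trm \<Rightarrow> bool" where
  refl: "lin_eq s s"
| sym: "lin_eq s t \<Longrightarrow> lin_eq t s"
| trans: "lin_eq s t \<Longrightarrow> lin_eq t u \<Longrightarrow> lin_eq s u"
| cong_add: "lin_eq s s' \<Longrightarrow> lin_eq t t' \<Longrightarrow> lin_eq (RAdd s t) (RAdd s' t')"
| cong_scale: "lin_eq s s' \<Longrightarrow> lin_eq (RScale r s) (RScale r s')"
| cong_ceil: "lin_eq s s' \<Longrightarrow> lin_eq (RCeil s) (RCeil s')"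
| add_assoc: "lin_eq (RAdd (RAdd s t) u) (RAdd s (RAdd t u))"
| add_commute: "lin_eq (RAdd s t) (RAdd t s)"
| add_zero: "lin_eq (RAdd (RConst 0) s) s"
| scale_add: "lin_eq (RScale r (RAdd s t)) (RAdd (RScale r s) (RScale r t))"
| scale_plus: "lin_eq (RScale (p + q) s) (RAdd (RScale p s) (RScale q s))"
| scale_scale: "lin_eq (RScale p (RScale q s)) (RScale (p * q) s)"
| scale_one: "lin_eq (RScale 1 s) s"
| scale_zero: "lin_eq (RScale 0 s) (RConst 0)"
| const_add: "lin_eq (RAdd (RConst p) (RConst q)) (RConst (p + q))"
| const_scale: "lin_eq (RScale p (RConst q)) (RConst (p * q))"

quotient_type 'v trm = "'v raw_trm" / lin_eq
  by (rule equivpI)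
     (auto intro!: reflpI sympI transpI intro: lin_eq.refl lin_eq.sym lin_eq.trans)

lift_definition var :: "'v \<Rightarrow> 'v trm" is RVar .

lift_definition const :: "rat \<Rightarrow> 'v trm" is RConst .

lift_definition ceil :: "'v trm \<Rightarrow> 'v trm" is RCeil
  by (rule lin_eq.cong_ceil)

lift_definition scale :: "rat \<Rightarrow> 'v trm \<Rightarrow> 'v trm" (infixr \<open>\<odot>\<close> 75) is RScale
  by (rule lin_eq.cong_scale)

instantiation trm :: (type) ab_group_add
begin

lift_definition zero_trm :: "'v trm" is "RConst 0" .

lift_definition plus_trm :: "'v trm \<Rightarrow> 'v trm \<Rightarrow> 'v trm" is RAdd
  by (rule lin_eq.cong_add)

lift_definition uminus_trm :: "'v trm \<Rightarrow> 'v trm" is "RScale (-1)"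
  by (rule lin_eq.cong_scale)

definition minus_trm :: "'v trm \<Rightarrow> 'v trm \<Rightarrow> 'v trm" where
  "minus_trm s t = s + - t"

instance
proof
  fix s t u :: "'v trm"
  show "s + t + u = s + (t + u)" by transfer (rule lin_eq.add_assoc)
  show "s + t = t + s" by transfer (rule lin_eq.add_commute)
  show "0 + s = s" by transfer (rule lin_eq.add_zero)
  show "- s + s = 0"
  proof transfer
    fix s :: "'v raw_trm"
    have "lin_eq (RAdd (RScale (-1) s) s) (RAdd (RScale (-1) s) (RScale 1 s))"
      by (intro lin_eq.cong_add lin_eq.refl lin_eq.sym[OF lin_eq.scale_one])
    moreover have "lin_eq (RAdd (RScale (-1) s) (RScale 1 s)) (RScale (-1 + 1) s)"
      by (rule lin_eq.sym[OF lin_eq.scale_plus])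
    moreover have "lin_eq (RScale (-1 + 1) s) (RConst 0)"
      using lin_eq.scale_zero[of s] by simp
    ultimately show "lin_eq (RAdd (RScale (-1) s) s) (RConst 0)"
      by (blast intro: lin_eq.trans)
  qed
  show "s - t = s + - t" by (rule minus_trm_def)
qed

end

interpretation trm: vector_space "scale :: rat \<Rightarrow> 'v trm \<Rightarrow> 'v trm"
proof
  fix p q :: rat and s t :: "'v trm"
  show "p \<odot> (s + t) = p \<odot> s + p \<odot> t" by transfer (rule lin_eq.scale_add)
  show "(p + q) \<odot> s = p \<odot> s + q \<odot> s" by transfer (rule lin_eq.scale_plus)
  show "p \<odot> q \<odot> s = (p * q) \<odot> s" by transfer (rule lin_eq.scale_scale)
  show "1 \<odot> s = s" by transfer (rule lin_eq.scale_one)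
qed


section \<open>Evaluation\<close>

primrec raw_eval :: "('v \<Rightarrow> int) \<Rightarrow> 'v raw_trm \<Rightarrow> rat" where
  "raw_eval \<sigma> (RVar v) = of_int (\<sigma> v)"
| "raw_eval \<sigma> (RConst q) = q"
| "raw_eval \<sigma> (RAdd s t) = raw_eval \<sigma> s + raw_eval \<sigma> t"
| "raw_eval \<sigma> (RScale r s) = r * raw_eval \<sigma> s"
| "raw_eval \<sigma> (RCeil s) = of_int \<lceil>raw_eval \<sigma> s\<rceil>"

lift_definition eval :: "('v \<Rightarrow> int) \<Rightarrow> 'v trm \<Rightarrow> rat" is raw_eval
proof -
  fix \<sigma> :: "'v \<Rightarrow> int" and s t :: "'v raw_trm"
  assume "lin_eq s t"
  then show "raw_eval \<sigma> s = raw_eval \<sigma> t"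
    by (induction rule: lin_eq.induct) (auto simp: algebra_simps)
qed


section \<open>Occurrence of variables\<close>

primrec raw_var_coeff :: "'v raw_trm \<Rightarrow> 'v \<Rightarrow> rat" where
  "raw_var_coeff (RVar w) v = (if w = v then 1 else 0)"
| "raw_var_coeff (RConst q) v = 0"
| "raw_var_coeff (RAdd s t) v = raw_var_coeff s v + raw_var_coeff t v"
| "raw_var_coeff (RScale r s) v = r * raw_var_coeff s v"
| "raw_var_coeff (RCeil s) v = 0"

lift_definition var_coeff :: "'v trm \<Rightarrow> 'v \<Rightarrow> rat" is raw_var_coeff
proof -
  fix s t :: "'v raw_trm"
  assume "lin_eq s t"
  then show "raw_var_coeff s = raw_var_coeff t"
    by (induction rule: lin_eq.induct) (auto simp: fun_eq_iff algebra_simps)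
qed

text \<open>\<open>ceil_coeff t u\<close> is the coefficient of the subterm \<open>ceil u\<close> in \<open>t\<close>, not counting
  occurrences inside other ceilings.\<close>

primrec raw_ceil_coeff :: "'v raw_trm \<Rightarrow> 'v raw_trm \<Rightarrow> rat" where
  "raw_ceil_coeff (RVar w) u = 0"
| "raw_ceil_coeff (RConst q) u = 0"
| "raw_ceil_coeff (RAdd s t) u = raw_ceil_coeff s u + raw_ceil_coeff t u"
| "raw_ceil_coeff (RScale r s) u = r * raw_ceil_coeff s u"
| "raw_ceil_coeff (RCeil s) u = (if lin_eq s u then 1 else 0)"

lift_definition ceil_coeff :: "'v trm \<Rightarrow> 'v trm \<Rightarrow> rat" is raw_ceil_coeff
proof -
  fix s t u u' :: "'v raw_trm"
  assume st: "lin_eq s t" and uu': "lin_eq u u'"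
  have eq: "lin_eq r u \<longleftrightarrow> lin_eq r u'" for r
    using uu' by (meson lin_eq.sym lin_eq.trans)
  have "raw_ceil_coeff s u = raw_ceil_coeff t u"
    using st
  proof (induction rule: lin_eq.induct)
    case (cong_ceil s s')
    then show ?case by simp (meson lin_eq.sym lin_eq.trans)
  qed (auto simp: algebra_simps)
  also have "\<dots> = raw_ceil_coeff t u'"
    by (induction t) (simp_all add: eq)
  finally show "raw_ceil_coeff s u = raw_ceil_coeff t u'" .
qed

inductive occurs :: "'v \<Rightarrow> 'v trm \<Rightarrow> bool" where
  occurs_var: "var_coeff t v \<noteq> 0 \<Longrightarrow> occurs v t"
| occurs_ceil: "ceil_coeff t u \<noteq> 0 \<Longrightarrow> occurs v u \<Longrightarrow> occurs v t"

definition vars :: "'v trm \<Rightarrow> 'v set" where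
  "vars t = {v. occurs v t}"


section \<open>Conjunctions of linear constraints\<close>

definition linear_trm :: "'v trm \<Rightarrow> bool" where
  "linear_trm t \<longleftrightarrow>
     (\<exists>S a q. finite S \<and> t = (\<Sum>v\<in>S. a v \<odot> var v) + const q)"

text \<open>\<open>LeZero t\<close> is the inequality \<open>t \<le> 0\<close> and \<open>EqZero t\<close> is the equality \<open>t = 0\<close>.\<close>

datatype 'v constr = LeZero (constr_trm: "'v trm") | EqZero (constr_trm: "'v trm")

type_synonym 'v conj = "'v constr list"

definition linear_conj :: "'v conj \<Rightarrow> bool" where
  "linear_conj C \<longleftrightarrow> (\<forall>k\<in>set C. linear_trm (constr_trm k))"

definition conj_vars :: "'v conj \<Rightarrow> 'v set" where
  "conj_vars C = (\<Union>k\<in>set C. vars (constr_trm k))"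

primrec holds :: "('v \<Rightarrow> int) \<Rightarrow> 'v constr \<Rightarrow> bool" where
  "holds \<sigma> (LeZero t) \<longleftrightarrow> eval \<sigma> t \<le> 0"
| "holds \<sigma> (EqZero t) \<longleftrightarrow> eval \<sigma> t = 0"

definition entails :: "'v conj \<Rightarrow> 'v constr \<Rightarrow> bool" where
  "entails C k \<longleftrightarrow> (\<forall>\<sigma>. (\<forall>h\<in>set C. holds \<sigma> h) \<longrightarrow> holds \<sigma> k)"


section \<open>Annotated sequents and interpolating rules\<close>

text \<open>For fixed \<open>A\<close> and \<open>B\<close>, the pair \<open>(t, t')\<close> stands for the annotated sequent
  \<open>(A, B) \<turnstile> (t \<le> 0) [t' \<le> 0]\<close>.\<close>

type_synonym 'v sequent = "'v trm \<times> 'v trm"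

fun valid :: "'v conj \<Rightarrow> 'v conj \<Rightarrow> 'v sequent \<Rightarrow> bool" where
  "valid A B (t, t') \<longleftrightarrow>
     entails A (LeZero t') \<and>
     entails B (LeZero (t - t')) \<and>
     vars t' \<subseteq> conj_vars A \<and> vars (t - t') \<subseteq> conj_vars B"

text \<open>
  \<open>rule_instance A B ps s\<close>: the sequent \<open>s\<close> is derived from the list of premises \<open>ps\<close> by a single
  application of one of the rules.  In \<open>Division\<close> the \<open>x\<^sub>i\<close>, \<open>y\<^sub>j\<close>, \<open>z\<^sub>k\<close> are pairwise distinct variables,
  given as the elements of the finite sets \<open>X\<close>, \<open>Y\<close>, \<open>Z\<close>; \<open>X\<close> and \<open>Y\<close>, and \<open>Y\<close> and \<open>Z\<close>, are disjoint by
  the occurrence conditions.  The term \<open>u\<close> is the constant \<open>c\<close>: it contains no variables, but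
  it may contain ceilings of constants left behind by earlier applications of \<open>Division\<close>.
  The term \<open>u'\<close> is the remainder \<open>c'\<close> of the annotation; ceilings may occur in it.
\<close>

inductive rule_instance :: "'v conj \<Rightarrow> 'v conj \<Rightarrow> 'v sequent list \<Rightarrow> 'v sequent \<Rightarrow> bool"
  for A B :: "'v conj" where
  Hyp_A: "LeZero t \<in> set A \<or> EqZero t \<in> set A \<Longrightarrow> rule_instance A B [] (t, t)"
| Hyp_B: "LeZero t \<in> set B \<or> EqZero t \<in> set B \<Longrightarrow> rule_instance A B [] (t, 0)"
| Comb: "c\<^sub>1 > 0 \<Longrightarrow> c\<^sub>2 > 0 \<Longrightarrow>
    rule_instance A B [(t\<^sub>1, t\<^sub>1'), (t\<^sub>2, t\<^sub>2')]
      (c\<^sub>1 \<odot> t\<^sub>1 + c\<^sub>2 \<odot> t\<^sub>2, c\<^sub>1 \<odot> t\<^sub>1' + c\<^sub>2 \<odot> t\<^sub>2')"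
| Division:
    "finite X \<Longrightarrow> finite Y \<Longrightarrow> finite Z \<Longrightarrow> X \<inter> Z = {} \<Longrightarrow>
     X \<inter> conj_vars B = {} \<Longrightarrow>
     Y \<subseteq> conj_vars A \<inter> conj_vars B \<Longrightarrow>
     Z \<inter> conj_vars A = {} \<Longrightarrow>
     vars u = {} \<Longrightarrow>
     d > 0 \<Longrightarrow>
     (\<forall>v\<in>X. d dvd a v) \<Longrightarrow> (\<forall>v\<in>Y. d dvd c v) \<Longrightarrow> (\<forall>v\<in>Z. d dvd b v) \<Longrightarrow>
     rule_instance A B
       [((\<Sum>v\<in>X. of_int (a v) \<odot> var v) + (\<Sum>v\<in>Y. of_int (c v) \<odot> var v)
           + (\<Sum>v\<in>Z. of_int (b v) \<odot> var v) + u,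
         (\<Sum>v\<in>X. of_int (a v) \<odot> var v) + (\<Sum>v\<in>Y. c' v \<odot> var v) + u')]
       ((\<Sum>v\<in>X. (of_int (a v) / of_int d) \<odot> var v)
           + (\<Sum>v\<in>Y. (of_int (c v) / of_int d) \<odot> var v)
           + (\<Sum>v\<in>Z. (of_int (b v) / of_int d) \<odot> var v)
           + ceil ((1 / of_int d) \<odot> u),
        (\<Sum>v\<in>X. (of_int (a v) / of_int d) \<odot> var v)
           + ceil ((1 / of_int d) \<odot> ((\<Sum>v\<in>Y. c' v \<odot> var v) + u')))"
  for X Y Z :: "'v set" and a b c :: "'v \<Rightarrow> int" and c' :: "'v \<Rightarrow> rat"
    and d :: int and u u' :: "'v trm"

end

theory Submission
  imports Defs
begin

text \<open>
  For \<open>Division\<close>, let \<open>s\<close> be the part of the annotation outside the \<open>x\<^sub>i\<close>. In \<open>A\<close>, the premise bounds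
  \<open>s / d\<close> by the integer \<open>- \<Sum> a\<^sub>i x\<^sub>i / d\<close>, which therefore also bounds \<open>\<lceil>s / d\<rceil>\<close>. In \<open>B\<close>, the
  premise says that an integer plus \<open>u / d\<close> is at most \<open>s / d\<close>, so one may take ceilings on both
  sides. A variable or ceiling of \<open>s\<close> could escape \<open>A\<close> or \<open>B\<close> only if its coefficient cancelled in
  the annotation \<open>t'\<close> or in \<open>t - t'\<close>; the occurrence conditions on the \<open>x\<^sub>i\<close>, \<open>y\<^sub>j\<close>, \<open>z\<^sub>k\<close> and the
  absence of variables in \<open>u\<close> exclude such cancellation.
\<close>

section \<open>Evaluation and coefficients\<close>

lemma eval_simps [simp]:
  "eval \<sigma> (var v) = of_int (\<sigma> v)"
  "eval \<sigma> 0 = 0"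
  "eval \<sigma> (s + t) = eval \<sigma> s + eval \<sigma> t"
  "eval \<sigma> (r \<odot> s) = r * eval \<sigma> s"
  "eval \<sigma> (ceil s) = of_int \<lceil>eval \<sigma> s\<rceil>"
  by (transfer; simp)+

lemma eval_diff [simp]: "eval \<sigma> (s - t) = eval \<sigma> s - eval \<sigma> t"
  unfolding minus_trm_def by transfer simp

lemma eval_sum [simp]: "eval \<sigma> (\<Sum>v\<in>S. f v) = (\<Sum>v\<in>S. eval \<sigma> (f v))"
  by (induction S rule: infinite_finite_induct) auto

lemma var_coeff_simps [simp]:
  "var_coeff (var w) v = (if w = v then 1 else 0)"
  "var_coeff 0 v = 0"
  "var_coeff (s + t) v = var_coeff s v + var_coeff t v"
  "var_coeff (r \<odot> s) v = r * var_coeff s v"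
  "var_coeff (ceil s) v = 0"
  by (transfer; simp)+

lemma var_coeff_diff [simp]: "var_coeff (s - t) v = var_coeff s v - var_coeff t v"
  unfolding minus_trm_def by transfer simp

lemma var_coeff_sum_var [simp]:
  "finite S \<Longrightarrow> var_coeff (\<Sum>w\<in>S. f w \<odot> var w) v = (if v \<in> S then f v else 0)"
  by (induction S rule: finite_induct) auto

lemma ceil_coeff_simps [simp]:
  "ceil_coeff (var w) u = 0"
  "ceil_coeff 0 u = 0"
  "ceil_coeff (s + t) u = ceil_coeff s u + ceil_coeff t u"
  "ceil_coeff (r \<odot> s) u = r * ceil_coeff s u"
  "ceil_coeff (ceil s) u = (if s = u then 1 else 0)"
  by (transfer; simp)+

lemma ceil_coeff_diff [simp]: "ceil_coeff (s - t) u = ceil_coeff s u - ceil_coeff t u"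
  unfolding minus_trm_def by transfer simp

lemma ceil_coeff_sum_var [simp]: "ceil_coeff (\<Sum>w\<in>S. f w \<odot> var w) u = 0"
  by (induction S rule: infinite_finite_induct) auto


section \<open>Variables of terms\<close>

text \<open>One unfolding of the inductive \<open>occurs\<close>. The right-hand side mentions
  \<open>vars\<close> again, so as an unrestricted rewrite rule it would loop; later uses
  instantiate the term.\<close>

lemma mem_vars_iff:
  "v \<in> vars t \<longleftrightarrow> var_coeff t v \<noteq> 0 \<or> (\<exists>u. ceil_coeff t u \<noteq> 0 \<and> v \<in> vars u)"
  unfolding vars_def by (auto intro: occurs.intros elim: occurs.cases)

lemma var_coeff_in_vars: "var_coeff t v \<noteq> 0 \<Longrightarrow> v \<in> vars t"
  unfolding vars_def by (simp add: occurs_var)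

lemma ceil_coeff_in_vars: "ceil_coeff t u \<noteq> 0 \<Longrightarrow> v \<in> vars u \<Longrightarrow> v \<in> vars t"
  unfolding vars_def by (auto intro: occurs_ceil)

lemma vars_cases [consumes 1, case_names var ceil]:
  assumes "v \<in> vars t"
  obtains "var_coeff t v \<noteq> 0" | u where "ceil_coeff t u \<noteq> 0" "v \<in> vars u"
  using assms[unfolded mem_vars_iff[of v t]] by (elim disjE exE conjE)

lemma vars_zero [simp]: "vars 0 = {}"
  by (auto simp: mem_vars_iff[of _ 0])

text \<open>Coefficients add, so one that is nonzero in the sum is nonzero in a summand.
  Cancellation rules out equality in general.\<close>

lemma vars_add: "vars (s + t) \<subseteq> vars s \<union> vars t"
proof
  fix v assume "v \<in> vars (s + t)"
  then show "v \<in> vars s \<union> vars t"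
  proof (cases rule: vars_cases)
    case var
    then have "var_coeff s v \<noteq> 0 \<or> var_coeff t v \<noteq> 0"
      by (cases "var_coeff s v = 0") simp_all
    then show ?thesis
      by (elim disjE) (simp_all add: var_coeff_in_vars)
  next
    case (ceil u)
    then have "ceil_coeff s u \<noteq> 0 \<or> ceil_coeff t u \<noteq> 0"
      by (cases "ceil_coeff s u = 0") simp_all
    then show ?thesis
      using ceil_coeff_in_vars[OF _ ceil(2)] by (elim disjE) simp_all
  qed
qed

lemma vars_scale: "vars (r \<odot> t) \<subseteq> vars t"
proof
  fix v assume "v \<in> vars (r \<odot> t)"
  then show "v \<in> vars t"
    by (auto simp: mem_vars_iff[of v "r \<odot> t"] mem_vars_iff[of v t])
qed

lemma vars_diff: "vars (s - t) \<subseteq> vars s \<union> vars t"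
  using vars_add[of s "(-1) \<odot> t"] vars_scale[of "-1" t] by simp blast

lemma vars_ceil [simp]: "vars (ceil t) = vars t"
  by (auto simp: mem_vars_iff[of _ "ceil t"] split: if_splits)

lemma vars_sum_var: "finite S \<Longrightarrow> vars (\<Sum>v\<in>S. f v \<odot> var v) = {v \<in> S. f v \<noteq> 0}"
  by (auto simp: mem_vars_iff[of _ "\<Sum>v\<in>S. f v \<odot> var v"] split: if_splits)

lemma vars_subset_conj_vars:
  "LeZero t \<in> set C \<or> EqZero t \<in> set C \<Longrightarrow> vars t \<subseteq> conj_vars C"
  unfolding conj_vars_def by force


section \<open>The rules\<close>

lemma entails_hyp: "LeZero t \<in> set C \<or> EqZero t \<in> set C \<Longrightarrow> entails C (LeZero t)"
  unfolding entails_def by force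

lemma entails_comb:
  assumes "c\<^sub>1 > 0" "c\<^sub>2 > 0" "entails C (LeZero t\<^sub>1)" "entails C (LeZero t\<^sub>2)"
  shows "entails C (LeZero (c\<^sub>1 \<odot> t\<^sub>1 + c\<^sub>2 \<odot> t\<^sub>2))"
  using assms unfolding entails_def
  by (auto intro!: add_nonpos_nonpos mult_nonneg_nonpos)

lemma valid_comb:
  assumes "c\<^sub>1 > 0" "c\<^sub>2 > 0" "valid A B (t\<^sub>1, t\<^sub>1')" "valid A B (t\<^sub>2, t\<^sub>2')"
  shows "valid A B (c\<^sub>1 \<odot> t\<^sub>1 + c\<^sub>2 \<odot> t\<^sub>2, c\<^sub>1 \<odot> t\<^sub>1' + c\<^sub>2 \<odot> t\<^sub>2')"
proof -
  have vars_comb: "vars (c\<^sub>1 \<odot> s + c\<^sub>2 \<odot> t) \<subseteq> V" if "vars s \<subseteq> V" "vars t \<subseteq> V" for s t and V :: "'a set"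
    using that vars_add[of "c\<^sub>1 \<odot> s" "c\<^sub>2 \<odot> t"] vars_scale[of c\<^sub>1 s] vars_scale[of c\<^sub>2 t] by blast
  \<comment> \<open>By linearity the condition on \<open>B\<close> takes the same shape as the one
    on \<open>A\<close>, so \<open>entails_comb\<close> and \<open>vars_comb\<close> serve
    both.\<close>
  have "(c\<^sub>1 \<odot> t\<^sub>1 + c\<^sub>2 \<odot> t\<^sub>2) - (c\<^sub>1 \<odot> t\<^sub>1' + c\<^sub>2 \<odot> t\<^sub>2') = c\<^sub>1 \<odot> (t\<^sub>1 - t\<^sub>1') + c\<^sub>2 \<odot> (t\<^sub>2 - t\<^sub>2')"
    by (simp add: trm.scale_right_diff_distrib)
  then show ?thesis
    using assms by (simp add: entails_comb vars_comb)
qed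

text \<open>Divisibility makes every \<open>f v div d\<close> exact, and \<open>k\<close> is the sum
  of \<open>(f v div d) * \<sigma> v\<close>. Having the same \<open>k\<close> in both equations
  links a sum in the premise to its quotient in the conclusion.\<close>

lemma sum_div_of_int:
  assumes "d > 0" "\<forall>v\<in>S. d dvd f v"
  obtains k where "(\<Sum>v\<in>S. of_int (f v) / of_int d * of_int (\<sigma> v)) = (of_int k :: rat)"
    and "(\<Sum>v\<in>S. of_int (f v) * of_int (\<sigma> v)) = (of_int d * of_int k :: rat)"
proof
  have f: "of_int (f v) = (of_int d * of_int (f v div d) :: rat)" if "v \<in> S" for v
    using assms(2) that by (metis dvd_mult_div_cancel of_int_mult)
  show "(\<Sum>v\<in>S. of_int (f v) / of_int d * of_int (\<sigma> v)) = (of_int (\<Sum>v\<in>S. f v div d * \<sigma> v) :: rat)"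
    using assms(1) by (simp add: f cong: sum.cong)
  show "(\<Sum>v\<in>S. of_int (f v) * of_int (\<sigma> v)) = (of_int d * of_int (\<Sum>v\<in>S. f v div d * \<sigma> v) :: rat)"
    by (simp add: f sum_distrib_left mult.assoc cong: sum.cong)
qed

lemma valid_division:
  fixes X Y Z :: "'v set" and a b c :: "'v \<Rightarrow> int" and c' :: "'v \<Rightarrow> rat" and d :: int and u u' :: "'v trm"
  defines "s \<equiv> (\<Sum>v\<in>Y. c' v \<odot> var v) + u'"
  defines "x \<equiv> \<Sum>v\<in>X. of_int (a v) \<odot> var v" and "y \<equiv> \<Sum>v\<in>Y. of_int (c v) \<odot> var v"
    and "z \<equiv> \<Sum>v\<in>Z. of_int (b v) \<odot> var v"
  defines "xd \<equiv> \<Sum>v\<in>X. (of_int (a v) / of_int d) \<odot> var v"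
    and "yd \<equiv> \<Sum>v\<in>Y. (of_int (c v) / of_int d) \<odot> var v"
    and "zd \<equiv> \<Sum>v\<in>Z. (of_int (b v) / of_int d) \<odot> var v"
  assumes fin [simp]: "finite X" "finite Y" "finite Z"
    and XZ: "X \<inter> Z = {}" and XB: "X \<inter> conj_vars B = {}"
    and Y: "Y \<subseteq> conj_vars A \<inter> conj_vars B" and ZA: "Z \<inter> conj_vars A = {}"
    and u: "vars u = {}" and d: "d > 0"
    and dvd: "\<forall>v\<in>X. d dvd a v" "\<forall>v\<in>Y. d dvd c v" "\<forall>v\<in>Z. d dvd b v"
    and prem: "valid A B (x + y + z + u, x + s)"
  shows "valid A B (xd + yd + zd + ceil ((1 / of_int d) \<odot> u), xd + ceil ((1 / of_int d) \<odot> s))"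
proof -
  \<comment> \<open>The part in the x_i stands in both components and cancels, so the conditions on
    \<open>B\<close> concern only the y_j, the z_k, \<open>u\<close> and \<open>s\<close>.\<close>
  have diff_prem: "x + y + z + u - (x + s) = y + z + u - s"
    by simp
  have diff_concl: "xd + yd + zd + p - (xd + q) = yd + zd + p - q" for p q
    by simp
  have A: "entails A (LeZero (x + s))" and varsA: "vars (x + s) \<subseteq> conj_vars A"
    and B: "entails B (LeZero (y + z + u - s))" and varsB: "vars (y + z + u - s) \<subseteq> conj_vars B"
    using prem unfolding valid.simps diff_prem by blast+

  \<comment> \<open>The two entailments for Division\<close>
  have entails_A: "entails A (LeZero (xd + ceil ((1 / of_int d) \<odot> s)))"
    unfolding entails_def
  proof (intro allI impI)
    fix \<sigma> assume "\<forall>h\<in>set A. holds \<sigma> h"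
    then have le: "eval \<sigma> x + eval \<sigma> s \<le> 0"
      using A unfolding entails_def by auto
    obtain k where k: "eval \<sigma> xd = of_int k" "eval \<sigma> x = of_int d * of_int k"
      unfolding x_def xd_def eval_sum eval_simps by (rule sum_div_of_int[OF d dvd(1)])
    have "eval \<sigma> s / of_int d \<le> of_int (- k)"
      using le d unfolding k by (simp add: field_simps)
    then have "\<lceil>eval \<sigma> s / of_int d\<rceil> \<le> - k"
      by (simp only: ceiling_le_iff)
    then show "holds \<sigma> (LeZero (xd + ceil ((1 / of_int d) \<odot> s)))"
      unfolding holds.simps eval_simps k by simp
  qed

  have entails_B: "entails B (LeZero (yd + zd + ceil ((1 / of_int d) \<odot> u) - ceil ((1 / of_int d) \<odot> s)))"
    unfolding entails_def
  proof (intro allI impI)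
    fix \<sigma> assume "\<forall>h\<in>set B. holds \<sigma> h"
    then have le: "eval \<sigma> y + eval \<sigma> z + eval \<sigma> u - eval \<sigma> s \<le> 0"
      using B unfolding entails_def by auto
    obtain k where k: "eval \<sigma> yd = of_int k" "eval \<sigma> y = of_int d * of_int k"
      unfolding y_def yd_def eval_sum eval_simps by (rule sum_div_of_int[OF d dvd(2)])
    obtain l where l: "eval \<sigma> zd = of_int l" "eval \<sigma> z = of_int d * of_int l"
      unfolding z_def zd_def eval_sum eval_simps by (rule sum_div_of_int[OF d dvd(3)])
    \<comment> \<open>The integer \<open>k + l\<close> is split off so that it can later be pulled
      out of the ceiling.\<close>
    have "eval \<sigma> u / of_int d + of_int (k + l) = (eval \<sigma> y + eval \<sigma> z + eval \<sigma> u) / of_int d"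
      using d unfolding k l by (simp add: add_divide_distrib)
    also have "\<dots> \<le> eval \<sigma> s / of_int d"
      using le d by (intro divide_right_mono) auto
    finally have "\<lceil>eval \<sigma> u / of_int d\<rceil> + (k + l) \<le> \<lceil>eval \<sigma> s / of_int d\<rceil>"
      unfolding ceiling_add_of_int[symmetric] by (rule ceiling_mono)
    then show "holds \<sigma> (LeZero (yd + zd + ceil ((1 / of_int d) \<odot> u) - ceil ((1 / of_int d) \<odot> s)))"
      unfolding holds.simps eval_simps eval_diff k l by simp
  qed

  \<comment> \<open>Occurrence conditions for Division\<close>
  have XY: "X \<inter> Y = {}" and YZ: "Y \<inter> Z = {}"
    using XB Y ZA by blast+
  \<comment> \<open>Ceilings in \<open>u\<close> enclose no variables, so they cannot cancel a
    ceiling of \<open>s\<close> in which some variable occurs.\<close>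
  have coeff_u: "var_coeff u v = 0" "ceil_coeff u w \<noteq> 0 \<Longrightarrow> v \<notin> vars w" for v w
    using u mem_vars_iff[of v u] by auto
  have coeff_A: "v \<in> conj_vars A" if "var_coeff (x + s) v \<noteq> 0" for v
    using subsetD[OF varsA var_coeff_in_vars[OF that]] .
  have coeff_B: "v \<in> conj_vars B" if "var_coeff (y + z + u - s) v \<noteq> 0" for v
    using subsetD[OF varsB var_coeff_in_vars[OF that]] .
  have coeffs: "var_coeff x v = (if v \<in> X then of_int (a v) else 0)"
    "var_coeff y v = (if v \<in> Y then of_int (c v) else 0)"
    "var_coeff z v = (if v \<in> Z then of_int (b v) else 0)" for v
    by (simp_all add: x_def y_def z_def)
  \<comment> \<open>As v is outside \<open>B\<close>, its coefficient in
    \<open>y + z + u - s\<close> vanishes, and only \<open>s\<close> can contribute to it.\<close>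
  have s_X: "var_coeff s v = 0" if "v \<in> X" for v
  proof -
    have "v \<notin> conj_vars B" "v \<notin> Y" "v \<notin> Z"
      using that XB XZ XY by blast+
    then show ?thesis
      using coeff_B[of v] by (auto simp: coeffs coeff_u)
  qed
  have vars_s: "vars s \<subseteq> conj_vars A \<inter> conj_vars B"
  proof
    fix v assume "v \<in> vars s"
    then consider "var_coeff s v \<noteq> 0" | w where "ceil_coeff s w \<noteq> 0" "v \<in> vars w"
      by (rule vars_cases)
    then show "v \<in> conj_vars A \<inter> conj_vars B"
    proof cases
      case 1
      \<comment> \<open>Outside \<open>X\<close> the coefficient in \<open>x + s\<close> is that of
        \<open>s\<close> alone.\<close>
      then have "v \<notin> X"
        using s_X by blast
      with 1 have "v \<in> conj_vars A"
        using coeff_A[of v] by (simp add: coeffs)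
      then have "v \<notin> Z"
        using ZA by blast
      \<comment> \<open>On \<open>Y\<close> the coefficient \<open>c v\<close> may cancel that of
        \<open>s\<close>, but there membership is a hypothesis; elsewhere only \<open>- s\<close>
        contributes.\<close>
      then have "v \<in> conj_vars B"
        using 1 coeff_B[of v] Y by (cases "v \<in> Y") (auto simp: coeffs coeff_u)
      with \<open>v \<in> conj_vars A\<close> show ?thesis ..
    next
      case 2
      \<comment> \<open>The sums \<open>x\<close>, \<open>y\<close>, \<open>z\<close> contain no
        ceilings, so up to sign the coefficient in \<open>s\<close> survives in both terms.\<close>
      have "ceil_coeff u w = 0"
        using coeff_u(2) 2(2) by blast
      then have "ceil_coeff (x + s) w \<noteq> 0" "ceil_coeff (y + z + u - s) w \<noteq> 0"
        using 2(1) by (simp_all add: x_def y_def z_def)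
      then show ?thesis
        using varsA varsB ceil_coeff_in_vars[OF _ 2(2)] by blast
    qed
  qed
  \<comment> \<open>By \<open>s_X\<close>, the coefficient of v in \<open>x + s\<close> is exactly
    \<open>a v\<close>.\<close>
  have vars_xd: "vars xd \<subseteq> conj_vars A"
    using coeff_A s_X by (auto simp: xd_def vars_sum_var coeffs)
  have vars_yd: "vars yd \<subseteq> conj_vars B"
    using Y by (auto simp: yd_def vars_sum_var)
  \<comment> \<open>Since \<open>vars_s\<close> already places \<open>s\<close> inside
    \<open>A\<close>, no z_k occurs in \<open>s\<close>, and \<open>b v\<close> survives in
    \<open>y + z + u - s\<close>.\<close>
  have "v \<in> conj_vars B" if "v \<in> Z" "b v \<noteq> 0" for v
  proof -
    have "v \<notin> vars s"
      using that(1) ZA vars_s by blast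
    then have "var_coeff s v = 0"
      using var_coeff_in_vars[of s v] by auto
    moreover have "v \<notin> Y"
      using that(1) YZ by blast
    ultimately show ?thesis
      using that coeff_B[of v] by (simp add: coeffs coeff_u)
  qed
  then have vars_zd: "vars zd \<subseteq> conj_vars B"
    by (auto simp: zd_def vars_sum_var)
  have vars_ceil_s: "vars (ceil ((1 / of_int d) \<odot> s)) \<subseteq> conj_vars A \<inter> conj_vars B"
    unfolding vars_ceil using vars_scale vars_s by (rule subset_trans)
  have vars_ceil_u: "vars (ceil ((1 / of_int d) \<odot> u)) = {}"
    using vars_scale[of "1 / of_int d" u] u by simp
  have "vars (xd + ceil ((1 / of_int d) \<odot> s)) \<subseteq> conj_vars A"
    by (rule subset_trans[OF vars_add]) (use vars_xd vars_ceil_s in blast)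
  moreover have "vars (yd + zd + ceil ((1 / of_int d) \<odot> u)) \<subseteq> conj_vars B"
    using vars_add[of "yd + zd"] vars_add[of yd zd] vars_yd vars_zd vars_ceil_u by blast
  then have "vars (yd + zd + ceil ((1 / of_int d) \<odot> u) - ceil ((1 / of_int d) \<odot> s)) \<subseteq> conj_vars B"
    by (intro subset_trans[OF vars_diff]) (use vars_ceil_s in blast)
  ultimately show ?thesis
    unfolding valid.simps diff_concl using entails_A entails_B by blast
qed

theorem theorem4p3:
  fixes A B :: "'v conj" and prems :: "'v sequent list" and concl :: "'v sequent"
  assumes "linear_conj A" and "linear_conj B"
    and "rule_instance A B prems concl"
    and "\<forall>s\<in>set prems. valid A B s"
  shows "valid A B concl"
  using assms(3,4)
proof cases
  case (Hyp_A t)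
  then show ?thesis
    \<comment> \<open>As \<open>t - t\<close> is \<open>0\<close>, the goal left for the second call
      is that \<open>B\<close> entails 0 \<le> 0.\<close>
    by (simp add: entails_hyp vars_subset_conj_vars) (simp add: entails_def)
next
  case (Hyp_B t)
  then show ?thesis
    \<comment> \<open>Here the annotation is \<open>0\<close>, and the trivial entailment is left
      for \<open>A\<close>.\<close>
    by (simp add: entails_hyp vars_subset_conj_vars) (simp add: entails_def)
next
  case (Comb c\<^sub>1 c\<^sub>2 t\<^sub>1 t\<^sub>1' t\<^sub>2 t\<^sub>2')
  then show ?thesis
    using assms(4) by (auto intro!: valid_comb simp del: valid.simps)
next
  case (Division X Y Z u d a c b c' u')
  show ?thesis
    unfolding Division(2)
    \<comment> \<open>Associativity regroups the annotation of the premise so that the y_j and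
      \<open>u'\<close> form the single term rounded up in the conclusion.\<close>
    by (rule valid_division[OF Division(3-14)])
       (use assms(4) Division(1) in \<open>simp add: add.assoc del: valid.simps\<close>)
qed

end
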